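(* Let $A\in\mathbb{R}^{n\times m}$, let $b\in\mathbb{R}^n$ lie in the span of the columns of $A$, and let $x^*$ be an optimal solution of $\min_{x\in\mathbb{R}^m:\, A x = b} \|x\|_\infty$. Let $r \in \Delta_m$ have strictly positive entries. Then \[ \|x^*\|_\infty^2 \geq b^\top \left(A\,\mathbf{D}(r)^{-1}A^{\top}\right)^+ b . \]
   Context: $\Delta_m=\{p\in\mathbb{R}^m: \sum_i p_i=1,\ p_i\ge 0\}$ is the probability simplex. For a vector $r$, $\mathbf{D}(r)$ is the diagonal matrix with diagonal $r$. For a symmetric matrix $L$, $L^+$ denotes its Moore–Penrose pseudoinverse. *)

theory Defs
  imports "HOL-Analysis.Analysis"
begin

text \<open>Diagonal matrix D(r) with diagonal r.\<close>
definition diag_mat :: "real ^ 'n \<Rightarrow> real ^ 'n ^ 'n" where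
  "diag_mat r = (\<chi> i j. if i = j then r $ i else 0)"

text \<open>Moore-Penrose pseudoinverse: the unique matrix satisfying the four Penrose conditions.\<close>
definition penrose :: "real ^ 'm ^ 'n \<Rightarrow> real ^ 'n ^ 'm \<Rightarrow> bool" where
  "penrose L X \<longleftrightarrow> L ** X ** L = L \<and> X ** L ** X = X \<and>
     transpose (L ** X) = L ** X \<and> transpose (X ** L) = X ** L"

definition pinv :: "real ^ 'm ^ 'n \<Rightarrow> real ^ 'n ^ 'm" where
  "pinv L = (THE X. penrose L X)"

text \<open>Probability prob_simplex.\<close>
definition prob_simplex :: "(real ^ 'm) set" where
  "prob_simplex = {p. (\<forall>i. p $ i \<ge> 0) \<and> sum (\<lambda>i. p $ i) UNIV = 1}"

end

theory Submission
  imports Defs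
begin

text \<open>
  Put \<open>E = D(r)\<^sup>-\<^sup>1\<close> and \<open>L = A E A\<^sup>T\<close>. Since \<open>L\<close> is symmetric, its kernel is orthogonal
  to its range and \<open>L\<close> is invertible on its range, which gives the pseudoinverse.
  For \<open>z = L\<^sup>+ b\<close> and \<open>w = A\<^sup>T z\<close> the number \<open>s = b\<^sup>T L\<^sup>+ b\<close> has two expressions:
  \<open>s = z\<^sup>T L z = \<Sum> w\<^sub>i\<^sup>2 / r\<^sub>i\<close> and \<open>s = b\<^sup>T z = x\<^sup>T w\<close> for any solution \<open>A x = b\<close>.
  Termwise AM-GM gives \<open>x\<^sup>T w \<le> (\<Sum> r\<^sub>i x\<^sub>i\<^sup>2 + \<Sum> w\<^sub>i\<^sup>2 / r\<^sub>i) / 2\<close>, i.e.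
  \<open>s \<le> (\<Sum> r\<^sub>i x\<^sub>i\<^sup>2 + s) / 2\<close>, so \<open>s \<le> \<Sum> r\<^sub>i x\<^sub>i\<^sup>2 \<le> \<parallel>x\<parallel>\<^sub>\<infinity>\<^sup>2\<close> as \<open>r\<close> is a probability vector.
\<close>

lemma symmetric_matrix_iff_inner:
  fixes M :: "real^'n^'n"
  shows "transpose M = M \<longleftrightarrow> (\<forall>x y. (M *v x) \<bullet> y = x \<bullet> (M *v y))"
proof
  assume "transpose M = M"
  then show "\<forall>x y. (M *v x) \<bullet> y = x \<bullet> (M *v y)"
    by (metis dot_lmul_matrix transpose_matrix_vector)
next
  assume sym: "\<forall>x y. (M *v x) \<bullet> y = x \<bullet> (M *v y)"
  have "transpose M *v x = M *v x" for x
  proof -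
    have "\<forall>y. (transpose M *v x - M *v x) \<bullet> y = 0"
      using sym by (simp add: inner_diff_left dot_lmul_matrix)
    then show ?thesis by (metis inner_eq_zero_iff eq_iff_diff_eq_0)
  qed
  then show "transpose M = M" by (simp add: matrix_eq)
qed

lemma symmetric_matrix_inj_on_range:
  fixes L :: "real^'n^'n"
  assumes "transpose L = L"
  shows "inj_on ((*v) L) (range ((*v) L))"
proof (rule inj_onI)
  fix x y assume "x \<in> range ((*v) L)" "y \<in> range ((*v) L)" and eq: "L *v x = L *v y"
  then obtain u where u: "x - y = L *v u"
    by (auto simp: matrix_vector_mult_diff_distrib[symmetric])
  have "(x - y) \<bullet> (x - y) = u \<bullet> (L *v (x - y))"
    using assms u by (metis symmetric_matrix_iff_inner)
  also have "\<dots> = 0" using eq by (simp add: matrix_vector_mult_diff_distrib)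
  finally show "x = y" by simp
qed

lemma symmetric_matrix_image_range:
  fixes L :: "real^'n^'n"
  assumes "transpose L = L"
  shows "(*v) L ` range ((*v) L) = range ((*v) L)"
proof (rule subspace_dim_equal)
  have lin: "linear ((*v) L)" by (rule matrix_vector_mul_linear)
  show "subspace (range ((*v) L))"
    by (intro real_vector.linear_subspace_image lin subspace_UNIV)
  then show "subspace ((*v) L ` range ((*v) L))"
    by (rule real_vector.linear_subspace_image[OF lin])
  show "(*v) L ` range ((*v) L) \<subseteq> range ((*v) L)" by auto
  show "dim (range ((*v) L)) \<le> dim ((*v) L ` range ((*v) L))"
  proof -
    have "span (range ((*v) L)) = range ((*v) L)"
      using \<open>subspace (range ((*v) L))\<close> by (rule span_eq_iff[THEN iffD2])
    then show ?thesis
      using dim_image_eq[OF lin, of "range ((*v) L)"] symmetric_matrix_inj_on_range[OF assms]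
      by (metis order_refl)
  qed
qed

lemma penrose_exists_symmetric:
  fixes L :: "real^'n^'n"
  assumes sym: "transpose L = L"
  shows "\<exists>X. penrose L X"
proof -
  define V where "V = range ((*v) L)"
  have inner_sym: "(L *v x) \<bullet> y = x \<bullet> (L *v y)" for x y
    using sym symmetric_matrix_iff_inner by blast
  have LV: "L *v x \<in> V" for x unfolding V_def by blast
  have V_image: "(*v) L ` V = V" and injV: "inj_on ((*v) L) V"
    unfolding V_def using symmetric_matrix_image_range[OF sym] symmetric_matrix_inj_on_range[OF sym]
    by simp_all
  have "subspace V" unfolding V_def
    by (intro real_vector.linear_subspace_image matrix_vector_mul_linear subspace_UNIV)
  then obtain g where g: "range g \<subseteq> V" "linear g" "\<And>v. v \<in> V \<Longrightarrow> g (L *v v) = v"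
    using real_vector.linear_exists_left_inverse_on[OF matrix_vector_mul_linear _ injV] by blast
  have gV: "g y \<in> V" for y using g(1) by blast
  have L_g: "L *v g y = y" if "y \<in> V" for y
    using that V_image g(3) by force
  \<comment> \<open>\<open>p = g \<circ> L\<close> is the orthogonal projection onto the range of \<open>L\<close>.\<close>
  define p where "p x = g (L *v x)" for x
  have L_p: "L *v p x = L *v x" for x unfolding p_def using L_g LV by blast
  have p_id: "p v = v" if "v \<in> V" for v
    using injV L_p gV that unfolding p_def by (meson inj_onD)
  have p_sym: "p x \<bullet> y = x \<bullet> p y" for x y
  proof -
    have ker_orth: "(z - p z) \<bullet> v = 0" if "v \<in> V" for z v
      using that L_p unfolding V_def
      by (auto simp: inner_sym[symmetric] matrix_vector_mult_diff_distrib)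
    have "p x \<bullet> y = p x \<bullet> p y"
      using ker_orth[of "p x" y] gV p_def by (simp add: inner_diff_right inner_commute)
    also have "\<dots> = x \<bullet> p y"
      using ker_orth[of "p y" x] gV p_def by (simp add: inner_diff_right inner_commute)
    finally show ?thesis .
  qed
  define X where "X = matrix (g \<circ> g \<circ> (*v) L)"
  have X: "X *v x = g (p x)" for x
    unfolding X_def p_def
    by (simp add: linear_compose g(2) matrix_vector_mul_linear matrix_works)
  have LX: "L *v (X *v x) = p x" for x using X L_g gV p_def by simp
  have XL: "X *v (L *v x) = p x" for x using X p_id LV p_def by simp
  have Xp: "X *v p x = X *v x" for x using X p_id gV p_def by simp
  have "penrose L X"
    unfolding penrose_def symmetric_matrix_iff_inner
    by (simp add: matrix_eq matrix_vector_mul_assoc[symmetric] LX XL L_p p_sym Xp)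
  then show ?thesis ..
qed

lemma penrose_transpose:
  assumes "penrose L X"
  shows "penrose (transpose L) (transpose X)"
  using assms unfolding penrose_def
  by (metis matrix_transpose_mul matrix_mul_assoc transpose_transpose)

lemma penrose_unique:
  fixes L :: "real^'m^'n"
  assumes X: "penrose L X" and Y: "penrose L Y"
  shows "X = Y"
proof -
  note tm = matrix_transpose_mul
  from X have X1: "L ** X ** L = L" and X2: "X ** L ** X = X"
    and X3: "transpose X ** transpose L = L ** X" and X4: "transpose L ** transpose X = X ** L"
    unfolding penrose_def by (auto simp: tm)
  from Y have Y1: "L ** Y ** L = L" and Y2: "Y ** L ** Y = Y"
    and Y3: "transpose Y ** transpose L = L ** Y" and Y4: "transpose L ** transpose Y = Y ** L"
    unfolding penrose_def by (auto simp: tm)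
  have "X = X ** (transpose X ** transpose L)" using X2 X3 by (simp add: matrix_mul_assoc)
  also have "\<dots> = X ** transpose X ** (transpose L ** transpose Y ** transpose L)"
    using Y1 by (metis tm matrix_mul_assoc)
  also have "\<dots> = X ** (transpose X ** transpose L) ** (transpose Y ** transpose L)"
    by (simp add: matrix_mul_assoc)
  also have "\<dots> = (X ** L ** X) ** L ** Y" using X3 Y3 by (simp add: matrix_mul_assoc)
  finally have XY: "X = X ** L ** Y" using X2 by simp
  have "Y = (transpose L ** transpose Y) ** Y" using Y2 Y4 by simp
  also have "\<dots> = (transpose L ** transpose X ** transpose L) ** transpose Y ** Y"
    using X1 by (metis tm matrix_mul_assoc)
  also have "\<dots> = (transpose L ** transpose X) ** (transpose L ** transpose Y) ** Y"
    by (simp add: matrix_mul_assoc)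
  also have "\<dots> = X ** L ** (Y ** L ** Y)" using X4 Y4 by (simp add: matrix_mul_assoc)
  finally show ?thesis using XY Y2 by simp
qed

lemma pinv_eqI:
  fixes L :: "real^'m^'n"
  assumes "penrose L X"
  shows "pinv L = X"
  unfolding pinv_def using assms penrose_unique by blast

lemma penrose_pinv_symmetric:
  fixes L :: "real^'n^'n"
  assumes "transpose L = L"
  shows "penrose L (pinv L)"
  using penrose_exists_symmetric[OF assms] pinv_eqI by metis

lemma transpose_pinv_symmetric:
  fixes L :: "real^'n^'n"
  assumes "transpose L = L"
  shows "transpose (pinv L) = pinv L"
  using penrose_transpose[OF penrose_pinv_symmetric[OF assms]] assms pinv_eqI by metis

lemma inner_pinv_symmetric:
  fixes L :: "real^'n^'n"
  assumes "transpose L = L"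
  shows "b \<bullet> (pinv L *v b) = (pinv L *v b) \<bullet> (L *v (pinv L *v b))"
proof -
  have "pinv L *v b = pinv L *v (L *v (pinv L *v b))"
    using penrose_pinv_symmetric[OF assms] unfolding penrose_def
    by (metis matrix_vector_mul_assoc)
  then show ?thesis
    using transpose_pinv_symmetric[OF assms] symmetric_matrix_iff_inner by metis
qed

lemma matrix_inv_eqI:
  fixes A :: "'a::semiring_1^'n^'n"
  assumes AB: "A ** B = mat 1" and BA: "B ** A = mat 1"
  shows "matrix_inv A = B"
proof -
  have "A ** matrix_inv A = mat 1 \<and> matrix_inv A ** A = mat 1"
    unfolding matrix_inv_def using AB BA by (rule someI[of _ B, OF conjI])
  then have "matrix_inv A = matrix_inv A ** (A ** B)" using AB by simp
  also have "\<dots> = B"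
    using \<open>A ** matrix_inv A = mat 1 \<and> matrix_inv A ** A = mat 1\<close> by (simp add: matrix_mul_assoc)
  finally show ?thesis .
qed

lemma diag_mat_mult:
  "diag_mat d ** diag_mat e = diag_mat (\<chi> i. d $ i * e $ i)"
  by (simp add: diag_mat_def matrix_matrix_mult_def vec_eq_iff if_distrib[of "\<lambda>x. x * _"]
      sum.delta cong: if_cong)

lemma diag_mat_one: "diag_mat (\<chi> i. 1) = mat 1"
  by (simp add: diag_mat_def mat_def vec_eq_iff)

lemma transpose_diag_mat: "transpose (diag_mat d) = diag_mat d"
  by (simp add: diag_mat_def transpose_def vec_eq_iff)

lemma matrix_inv_diag_mat:
  assumes "\<forall>i. d $ i \<noteq> (0::real)"
  shows "matrix_inv (diag_mat d) = diag_mat (\<chi> i. inverse (d $ i))"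
  using assms by (intro matrix_inv_eqI) (simp_all add: diag_mat_mult diag_mat_one)

lemma inner_diag_mat: "x \<bullet> (diag_mat d *v x) = (\<Sum>i\<in>UNIV. d $ i * (x $ i)\<^sup>2)"
  by (simp add: inner_vec_def diag_mat_def matrix_vector_mult_def power2_eq_square
      if_distrib[of "\<lambda>y. _ * y"] mult_ac cong: if_cong)

lemma mult_le_weighted_squares:
  fixes r x w :: real
  assumes "r > 0"
  shows "x * w \<le> (r * x\<^sup>2 + inverse r * w\<^sup>2) / 2"
proof -
  have "0 \<le> (r * x - w)\<^sup>2 / r" using assms by simp
  also have "\<dots> = r * x\<^sup>2 + inverse r * w\<^sup>2 - 2 * x * w"
    using assms by (simp add: field_simps power2_eq_square)
  finally show ?thesis by simp
qed

lemma inner_pinv_weighted_gram_le: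
  fixes A :: "real^'m^'n" and x r :: "real^'m"
  assumes r: "\<forall>i. r $ i > 0"
  shows "(A *v x) \<bullet> (pinv (A ** matrix_inv (diag_mat r) ** transpose A) *v (A *v x))
           \<le> (\<Sum>i\<in>UNIV. r $ i * (x $ i)\<^sup>2)"
proof -
  define E where "E = diag_mat (\<chi> i. inverse (r $ i))"
  define L where "L = A ** E ** transpose A"
  define z where "z = pinv L *v (A *v x)"
  define w where "w = transpose A *v z"
  define s where "s = (A *v x) \<bullet> z"
  have E: "matrix_inv (diag_mat r) = E"
    unfolding E_def using r by (simp add: matrix_inv_diag_mat less_imp_neq[symmetric])
  have L_sym: "transpose L = L"
    unfolding L_def by (simp add: matrix_transpose_mul E_def transpose_diag_mat matrix_mul_assoc)
  have s_primal: "s = (\<Sum>i\<in>UNIV. x $ i * w $ i)"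
    unfolding s_def w_def using dot_lmul_matrix[of x "transpose A" z]
    by (simp add: inner_vec_def)
  have "s = z \<bullet> (L *v z)"
    unfolding s_def z_def by (rule inner_pinv_symmetric[OF L_sym])
  also have "\<dots> = w \<bullet> (E *v w)"
    unfolding L_def w_def by (simp add: dot_lmul_matrix matrix_vector_mul_assoc[symmetric])
  finally have s_dual: "s = (\<Sum>i\<in>UNIV. inverse (r $ i) * (w $ i)\<^sup>2)"
    unfolding E_def inner_diag_mat by simp
  have "s \<le> (\<Sum>i\<in>UNIV. (r $ i * (x $ i)\<^sup>2 + inverse (r $ i) * (w $ i)\<^sup>2) / 2)"
    unfolding s_primal using r by (intro sum_mono mult_le_weighted_squares) simp
  also have "\<dots> = ((\<Sum>i\<in>UNIV. r $ i * (x $ i)\<^sup>2) + s) / 2"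
    unfolding s_dual by (simp add: sum.distrib sum_divide_distrib[symmetric])
  finally show ?thesis unfolding s_def z_def L_def E by simp
qed

lemma prob_simplex_weighted_squares_le_infnorm:
  fixes r x :: "real^'m"
  assumes "r \<in> prob_simplex"
  shows "(\<Sum>i\<in>UNIV. r $ i * (x $ i)\<^sup>2) \<le> (infnorm x)\<^sup>2"
proof -
  have "(\<Sum>i\<in>UNIV. r $ i * (x $ i)\<^sup>2) \<le> (\<Sum>i\<in>UNIV. r $ i * (infnorm x)\<^sup>2)"
  proof (rule sum_mono)
    fix i
    have "\<bar>x $ i\<bar>\<^sup>2 \<le> (infnorm x)\<^sup>2"
      by (rule power_mono[OF component_le_infnorm_cart abs_ge_zero])
    then show "r $ i * (x $ i)\<^sup>2 \<le> r $ i * (infnorm x)\<^sup>2"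
      using assms by (intro mult_left_mono) (auto simp: prob_simplex_def)
  qed
  also have "\<dots> = (infnorm x)\<^sup>2"
    using assms unfolding prob_simplex_def by (simp add: sum_distrib_right[symmetric])
  finally show ?thesis .
qed

theorem lemma2p1:
  fixes A :: "real ^ 'm ^ 'n" and b :: "real ^ 'n" and xs :: "real ^ 'm" and r :: "real ^ 'm"
  assumes "b \<in> range (\<lambda>x. A *v x)"
    and "A *v xs = b"
    and "\<forall>x. A *v x = b \<longrightarrow> infnorm xs \<le> infnorm x"
    and "r \<in> prob_simplex"
    and "\<forall>i. r $ i > 0"
  shows "(infnorm xs)\<^sup>2 \<ge> b \<bullet> (pinv (A ** matrix_inv (diag_mat r) ** transpose A) *v b)"
  using inner_pinv_weighted_gram_le[OF assms(5), of A xs]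
    prob_simplex_weighted_squares_le_infnorm[OF assms(4), of xs] assms(2)
  by simp
end
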